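(* Let $A$ be a unital $C^*$-algebra and let $x\in A$ satisfy $x=x^*$. If $\lambda\in\sigma(x)$, then $\lambda$ is an eigenvalue of $x$; that is, there exists a state $E\in S(A)$ such that $E(yx)=\lambda E(y)$ for all $y\in A$.
   Context: $A$ is a $C^*$-algebra with unit $1$ and $\sigma(x)$ denotes the spectrum of $x$ in $A$. The state space $S(A)$ is the set of normalized positive linear functionals $E\colon A\to\mathbb{C}$ (i.e. $E(y^*y)\ge 0$ for all $y\in A$ and $E(1)=1$). A state $E\in S(A)$ is an eigenstate of $x\in A$ with eigenvalue $\lambda\in\mathbb{C}$ if $E(yx)=\lambda E(y)$ for all $y\in A$. A number $\lambda\in\mathbb{C}$ is an eigenvalue of $x$ if there is an eigenstate of $x$ with eigenvalue $\lambda$. *)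

theory Defs
  imports "HOL-Analysis.Analysis"
begin

(* The library has only real vector spaces and real normed algebras; the complex
   structure is added on top of these, compatibly with scaleR. *)

class complex_vector = real_vector +
  fixes scaleC :: "complex \<Rightarrow> 'a \<Rightarrow> 'a" (infixr \<open>*\<^sub>C\<close> 75)
  assumes scaleC_add_right: "a *\<^sub>C (x + y) = a *\<^sub>C x + a *\<^sub>C y"
    and scaleC_add_left: "(a + b) *\<^sub>C x = a *\<^sub>C x + b *\<^sub>C x"
    and scaleC_scaleC: "a *\<^sub>C b *\<^sub>C x = (a * b) *\<^sub>C x"
    and scaleC_one: "1 *\<^sub>C x = x"
    and scaleR_scaleC: "r *\<^sub>R x = complex_of_real r *\<^sub>C x"

lemma vector_space_scaleC: "vector_space (scaleC :: complex \<Rightarrow> 'a \<Rightarrow> 'a::complex_vector)"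
  by unfold_locales (simp_all add: scaleC_add_right scaleC_add_left scaleC_scaleC scaleC_one)

(* zero_neq_one excludes the zero algebra, where every spectrum is empty;
   norm 1 = 1 follows from the norm identity below in every other case. *)

class unital_cstar_algebra = real_normed_algebra_1 + banach + complex_vector +
  fixes star :: "'a \<Rightarrow> 'a"
  assumes scaleC_mult_left: "(a *\<^sub>C x) * y = a *\<^sub>C (x * y)"
    and scaleC_mult_right: "x * (a *\<^sub>C y) = a *\<^sub>C (x * y)"
    and norm_scaleC: "norm (a *\<^sub>C x) = cmod a * norm x"
    and star_star: "star (star x) = x"
    and star_add: "star (x + y) = star x + star y"
    and star_scaleC: "star (a *\<^sub>C x) = cnj a *\<^sub>C star x"
    and star_mult: "star (x * y) = star y * star x"
    and norm_star_mult_self: "norm (star x * x) = (norm x)\<^sup>2"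

definition invertible_element :: "'a::monoid_mult \<Rightarrow> bool" where
  "invertible_element x \<longleftrightarrow> (\<exists>y. x * y = 1 \<and> y * x = 1)"

definition spectrum :: "'a::unital_cstar_algebra \<Rightarrow> complex set" where
  "spectrum x = {\<mu>. \<not> invertible_element (x - \<mu> *\<^sub>C 1)}"

definition state_space :: "('a::unital_cstar_algebra \<Rightarrow> complex) set" where
  "state_space = {E. Vector_Spaces.linear scaleC (*) E
     \<and> (\<forall>y. E (star y * y) \<in> \<real>\<^sub>\<ge>\<^sub>0) \<and> E 1 = 1}"

definition is_eigenstate ::
  "('a::unital_cstar_algebra \<Rightarrow> complex) \<Rightarrow> 'a \<Rightarrow> complex \<Rightarrow> bool" where
  "is_eigenstate E x \<mu> \<longleftrightarrow> E \<in> state_space \<and> (\<forall>y. E (y * x) = \<mu> * E y)"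

definition is_eigenvalue :: "complex \<Rightarrow> 'a::unital_cstar_algebra \<Rightarrow> bool" where
  "is_eigenvalue \<mu> x \<longleftrightarrow> (\<exists>E. is_eigenstate E x \<mu>)"

end

theory Submission
  imports Defs
begin

text \<open>
  Put \<open>a = x - \<mu> 1\<close>. The spectrum of a self-adjoint element is real, so \<open>a\<close> is self-adjoint, and
  it is not invertible. If a state \<open>E\<close> satisfies \<open>E (a\<^sup>2) = 0\<close>, then the Cauchy-Schwarz inequality
  gives \<open>E (y a) = 0\<close> for all \<open>y\<close>, which is the eigenvalue equation. So everything reduces to
  finding a state that vanishes on \<open>a\<^sup>2\<close> (\<open>state_vanishing_on_square\<close>).

  Such a state comes from separating \<open>- 1\<close> from the convex cone generated by the positive elements
  and \<open>- a\<^sup>2\<close> (\<open>separating_functional\<close>). If \<open>- 1\<close> were in that cone, then \<open>s a\<^sup>2 - 1\<close> would be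
  positive for some \<open>s \<ge> 0\<close>; adding \<open>1\<close> to a positive element gives an invertible one
  (\<open>invertible_add_positive\<close>), so \<open>s a\<^sup>2\<close>, and with it \<open>a\<close>, would be invertible.

  For this the positive elements must form a convex cone that contains all \<open>y\<^sup>* y\<close>. The proof uses
  neither the spectral radius formula nor Gelfand theory. A self-adjoint \<open>h\<close> is called positive if
  \<open>\<parallel>t 1 - h\<parallel> \<le> t\<close> for some \<open>t\<close>, which makes closure under sums immediate. The power series of
  \<open>1 - sqrt (1 - k)\<close> has nonnegative coefficients with sum at most \<open>1\<close>, so it converges on the whole
  closed unit ball, and it yields exact square roots of positive elements (\<open>positive_sqrt\<close>).
  Conversely, squares of self-adjoint elements are positive: if \<open>s\<^sup>2 + h\<^sup>2 = 1\<close> with \<open>s\<close>, \<open>h\<close>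
  commuting, then \<open>s + \<i> h\<close> has norm \<open>1\<close>, so \<open>\<parallel>s\<parallel> \<le> 1\<close> (\<open>norm_le_norm_sum_squares\<close>). With these
  two facts Kaplansky's argument gives the positivity of \<open>y\<^sup>* y\<close> (\<open>positive_star_mult_self\<close>).
\<close>

section \<open>The coefficients of the series of 1 - sqrt (1 - z)\<close>

text \<open>
  If \<open>B = 1 - sqrt (1 - z)\<close>, then \<open>2 B = z + B\<^sup>2\<close>; comparing coefficients gives this recursion (of
  rescaled Catalan numbers). It shows nonnegativity at once, which the closed form by generalised
  binomial coefficients does not.
\<close>

function sqrt_coeff :: "nat \<Rightarrow> real" where
  "sqrt_coeff n = (if n = 0 then 0 else if n = 1 then 1/2 else (\<Sum>i\<in>{1..<n}. sqrt_coeff i * sqrt_coeff (n - i)) / 2)"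
  by auto
termination by lexicographic_order
declare sqrt_coeff.simps [simp del]
lemma sqrt_coeff_0 [simp]: "sqrt_coeff 0 = 0" by (simp add: sqrt_coeff.simps)

lemma sqrt_coeff_nonneg: "sqrt_coeff n \<ge> 0"
proof (induction n rule: less_induct)
  case (less n)
  have "(\<Sum>i\<in>{1..<n}. sqrt_coeff i * sqrt_coeff (n - i)) \<ge> 0"
    using less by (intro sum_nonneg mult_nonneg_nonneg) auto
  then show ?case by (subst sqrt_coeff.simps) auto
qed

lemma sqrt_coeff_convolution:
  "(\<Sum>i\<le>n. sqrt_coeff i * sqrt_coeff (n - i)) = 2 * sqrt_coeff n - (if n = 1 then 1 else 0)"
proof -
  have "(\<Sum>i\<le>n. sqrt_coeff i * sqrt_coeff (n - i)) = (\<Sum>i\<in>{1..<n}. sqrt_coeff i * sqrt_coeff (n - i))"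
  proof (rule sum.mono_neutral_right)
    show "\<forall>i\<in>{..n} - {1..<n}. sqrt_coeff i * sqrt_coeff (n - i) = 0"
    proof
      fix i assume "i \<in> {..n} - {1..<n}"
      then have "i = 0 \<or> i = n" by auto
      then show "sqrt_coeff i * sqrt_coeff (n - i) = 0" by auto
    qed
  qed auto
  then show ?thesis by (subst (3) sqrt_coeff.simps) auto
qed

text \<open>
  The partial sums \<open>S\<^sub>N\<close> satisfy \<open>2 S\<^sub>N\<^sub>+\<^sub>1 \<le> 1 + S\<^sub>N\<^sup>2\<close>, because the coefficients of \<open>B\<^sup>2\<close> up to degree
  \<open>N + 1\<close> only involve products of coefficients of \<open>B\<close> of degree at most \<open>N\<close>.
\<close>

lemma sqrt_coeff_partial_sum_le: "(\<Sum>n\<le>N. sqrt_coeff n) \<le> 1"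
proof (induction N)
  case 0 show ?case by simp
next
  case (Suc N)
  let ?c = sqrt_coeff
  have "(\<Sum>n\<le>Suc N. \<Sum>i\<le>n. ?c i * ?c (n - i)) = (\<Sum>(i,j)\<in>{(i,j). i + j \<le> Suc N}. ?c i * ?c j)"
    by (rule sum.triangle_reindex_eq [symmetric])
  also have "\<dots> = (\<Sum>(i,j)\<in>{(i,j). i + j \<le> Suc N} \<inter> {..N} \<times> {..N}. ?c i * ?c j)"
  proof (rule sum.mono_neutral_right)
    show "finite {(i,j). i + j \<le> Suc N}"
      by (rule finite_subset [of _ "{..Suc N} \<times> {..Suc N}"]) auto
    show "\<forall>p\<in>{(i,j). i + j \<le> Suc N} - {(i,j). i + j \<le> Suc N} \<inter> {..N} \<times> {..N}. (case p of (i,j) \<Rightarrow> ?c i * ?c j) = 0"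
    proof clarify
      fix i j assume "i + j \<le> Suc N" "(i,j) \<notin> {(i,j). i + j \<le> Suc N} \<inter> {..N} \<times> {..N}"
      then have "i = 0 \<or> j = 0" by auto
      then show "?c i * ?c j = 0" by auto
    qed
  qed auto
  also have "\<dots> \<le> (\<Sum>(i,j)\<in>{..N} \<times> {..N}. ?c i * ?c j)"
    by (rule sum_mono2) (auto simp: sqrt_coeff_nonneg)
  also have "\<dots> = (\<Sum>n\<le>N. ?c n)\<^sup>2"
    by (simp add: power2_eq_square sum_product sum.cartesian_product)
  also have "\<dots> \<le> 1"
    using Suc by (simp add: power_le_one sum_nonneg sqrt_coeff_nonneg)
  finally have "(\<Sum>n\<le>Suc N. 2 * ?c n - (if n = 1 then 1 else 0)) \<le> 1"
    by (simp only: sqrt_coeff_convolution)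
  moreover have "(\<Sum>n\<le>Suc N. (if n = 1 then 1 else 0 :: real)) = 1" by (subst sum.delta) auto
  ultimately show ?case by (simp only: sum_subtractf sum_distrib_left [symmetric]) 
qed

lemma summable_sqrt_coeff: "summable sqrt_coeff"
  by (rule bounded_imp_summable [OF sqrt_coeff_nonneg sqrt_coeff_partial_sum_le])

lemma suminf_sqrt_coeff_le: "(\<Sum>n. sqrt_coeff n) \<le> 1"
proof (rule suminf_le_const [OF summable_sqrt_coeff])
  show "sum sqrt_coeff {..<N} \<le> 1" for N
    using sqrt_coeff_partial_sum_le [of "N - 1"] by (cases N) (auto simp: lessThan_Suc_atMost)
qed

section \<open>Separation from a convex cone with an order unit\<close>

text \<open>
  A cone \<open>M\<close> that is maximal among those that contain \<open>C\<close> but not \<open>- e\<close> satisfies \<open>M \<union> - M = UNIV\<close>, so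
  it orders the whole space. As \<open>e\<close> is an order unit, each \<open>h\<close> cuts the line of multiples of \<open>e\<close> at
  one real number, and this number is \<open>f h\<close>.
\<close>

lemma separating_functional:
  fixes C :: "'v::real_vector set" and e :: 'v
  assumes cone: "convex_cone C"
    and unit: "\<And>h. \<exists>t. t *\<^sub>R e - h \<in> C"
    and proper: "- e \<notin> C"
  obtains f :: "'v \<Rightarrow> real" where "linear f" "\<And>h. h \<in> C \<Longrightarrow> f h \<ge> 0" "f e = 1"
proof -
  define cones where "cones = {K. convex_cone K \<and> C \<subseteq> K \<and> - e \<notin> K}"
  have "\<exists>M\<in>cones. \<forall>X\<in>cones. M \<subseteq> X \<longrightarrow> X = M"
  proof (rule subset_Zorn_nonempty)
    have "C \<in> cones" using assms by (auto simp: cones_def)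
    then show "cones \<noteq> {}" by auto
    fix \<C> assume ne: "\<C> \<noteq> {}" and ch: "subset.chain cones \<C>"
    have sub: "\<C> \<subseteq> cones" and tot: "\<And>X Y. X \<in> \<C> \<Longrightarrow> Y \<in> \<C> \<Longrightarrow> X \<subseteq> Y \<or> Y \<subseteq> X"
      using ch by (auto simp: subset_chain_def)
    have "h + k \<in> \<Union>\<C>" if "h \<in> \<Union>\<C>" "k \<in> \<Union>\<C>" for h k
    proof -
      obtain X Y where "X \<in> \<C>" "Y \<in> \<C>" "h \<in> X" "k \<in> Y" using \<open>h \<in> \<Union>\<C>\<close> \<open>k \<in> \<Union>\<C>\<close> by auto
      then obtain Z where "Z \<in> \<C>" "h \<in> Z" "k \<in> Z" using tot by blast
      moreover have "convex_cone Z" using sub \<open>Z \<in> \<C>\<close> by (auto simp: cones_def)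
      ultimately show ?thesis using convex_cone_add by blast
    qed
    moreover have "C \<subseteq> \<Union>\<C>" "- e \<notin> \<Union>\<C>" "0 \<in> \<Union>\<C>" "\<forall>h\<in>\<Union>\<C>. \<forall>r\<ge>0. r *\<^sub>R h \<in> \<Union>\<C>"
      using ne sub by (fastforce simp: cones_def convex_cone_iff)+
    ultimately show "\<Union>\<C> \<in> cones" unfolding cones_def convex_cone_iff by blast
  qed
  then obtain M where M: "M \<in> cones" and max: "\<And>X. X \<in> cones \<Longrightarrow> M \<subseteq> X \<Longrightarrow> X = M" by blast
  have CM: "C \<subseteq> M" and Madd: "\<And>h k. h \<in> M \<Longrightarrow> k \<in> M \<Longrightarrow> h + k \<in> M" and M0: "0 \<in> M"
    and Mscale: "\<And>r h. r \<ge> 0 \<Longrightarrow> h \<in> M \<Longrightarrow> r *\<^sub>R h \<in> M" and Mproper: "- e \<notin> M"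
    using M by (auto simp: cones_def convex_cone_iff)
  \<comment> \<open>Adjoining a vector outside \<open>M\<close> must put \<open>- e\<close> into the enlarged cone, by maximality.\<close>
  have extend: "\<exists>m\<in>M. \<exists>s>0. m + s *\<^sub>R h = - e" if "h \<notin> M" for h
  proof -
    define X where "X = {m + s *\<^sub>R h | m s. m \<in> M \<and> s \<ge> 0}"
    have "M \<subseteq> X" unfolding X_def by (force intro: exI [of _ 0])
    have "h \<in> X" unfolding X_def using M0 by (auto intro!: exI [of _ 0] exI [of _ 1])
    then have "X \<noteq> M" using that by auto
    then have "X \<notin> cones" using max \<open>M \<subseteq> X\<close> by auto
    moreover have "a + b \<in> X" if ab: "a \<in> X" "b \<in> X" for a b
    proof -
      obtain m s m' s' where "a = m + s *\<^sub>R h" "b = m' + s' *\<^sub>R h" "m \<in> M" "m' \<in> M" "s \<ge> 0" "s' \<ge> 0"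
        using ab unfolding X_def by blast
      then have "a + b = (m + m') + (s + s') *\<^sub>R h \<and> m + m' \<in> M \<and> s + s' \<ge> 0"
        by (auto simp: Madd algebra_simps)
      then show ?thesis unfolding X_def by blast
    qed
    moreover have "r *\<^sub>R a \<in> X" if ra: "r \<ge> 0" "a \<in> X" for r a
    proof -
      obtain m s where "a = m + s *\<^sub>R h" "m \<in> M" "s \<ge> 0"
        using ra unfolding X_def by blast
      then have "r *\<^sub>R a = r *\<^sub>R m + (r * s) *\<^sub>R h \<and> r *\<^sub>R m \<in> M \<and> r * s \<ge> 0"
        using ra by (auto simp: Mscale algebra_simps)
      then show ?thesis unfolding X_def by blast
    qed
    ultimately have "- e \<in> X"
      using CM M0 \<open>M \<subseteq> X\<close> unfolding cones_def convex_cone_iff by blast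
    then obtain m s where ms: "m \<in> M" "s \<ge> 0" "m + s *\<^sub>R h = - e" unfolding X_def by auto
    moreover have "s \<noteq> 0" using ms Mproper by auto
    ultimately show ?thesis by (intro bexI [of _ m] exI [of _ s]) auto
  qed
  have neg: "t \<le> 0" if "t *\<^sub>R (- e) \<in> M" for t :: real
  proof (rule ccontr)
    assume "\<not> t \<le> 0"
    then have "(1 / t) *\<^sub>R (t *\<^sub>R (- e)) \<in> M" by (intro Mscale [OF _ that]) simp
    moreover have "(1 / t) *\<^sub>R (t *\<^sub>R (- e)) = - e" using \<open>\<not> t \<le> 0\<close> by simp
    ultimately show False using Mproper by simp
  qed
  have total: "- h \<in> M" if nh: "h \<notin> M" for h
  proof (rule ccontr)
    assume "- h \<notin> M"
    then obtain m s m' s' where ms: "m \<in> M" "s > 0" "m + s *\<^sub>R h = - e" "m' \<in> M" "s' > 0" "m' + s' *\<^sub>R (- h) = - e"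
      using extend [OF nh] extend [OF \<open>- h \<notin> M\<close>] by blast
    \<comment> \<open>The weights \<open>s'\<close> and \<open>s\<close> make the multiples of \<open>h\<close> cancel.\<close>
    have "s' *\<^sub>R m + s *\<^sub>R m' = s' *\<^sub>R (m + s *\<^sub>R h) + s *\<^sub>R (m' + s' *\<^sub>R (- h))"
      by (simp add: algebra_simps)
    also have "\<dots> = (s + s') *\<^sub>R (- e)" by (simp only: ms) (simp add: algebra_simps)
    finally have "(s + s') *\<^sub>R (- e) \<in> M"
      using Madd [OF Mscale [of s' m] Mscale [of s m']] ms by simp
    then show False using neg [of "s + s'"] ms by simp
  qed
  have eM: "e \<in> M" using total [of "-e"] Mproper by simp
  define L where "L h = {t. h - t *\<^sub>R e \<in> M}" for h
  define f where "f h = Sup (L h)" for h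
  have Lne: "L h \<noteq> {}" for h
  proof -
    obtain t where "t *\<^sub>R e - (- h) \<in> C" using unit by blast
    then have "- t \<in> L h" using CM by (auto simp: L_def add.commute)
    then show ?thesis by auto
  qed
  have below: "t \<le> s" if "t \<in> L h" "s *\<^sub>R e - h \<in> M" for t s h
  proof -
    have "(h - t *\<^sub>R e) + (s *\<^sub>R e - h) \<in> M" using that by (intro Madd) (auto simp: L_def)
    moreover have "(h - t *\<^sub>R e) + (s *\<^sub>R e - h) = (t - s) *\<^sub>R (- e)" by (simp add: algebra_simps)
    ultimately show ?thesis using neg [of "t - s"] by simp
  qed
  have Lbdd: "bdd_above (L h)" for h
    using unit [of h] CM below unfolding bdd_above_def by blast
  have upper: "t \<le> f h" if "h - t *\<^sub>R e \<in> M" for t h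
    unfolding f_def using that Lbdd by (intro cSup_upper) (auto simp: L_def)
  have lower: "f h \<le> s" if "s *\<^sub>R e - h \<in> M" for s h
    unfolding f_def using that below Lne by (intro cSup_least) auto
  \<comment> \<open>As a supremum of lower cuts, \<open>f\<close> is superadditive; totality of \<open>M\<close> makes it odd, and a
    superadditive odd function is additive.\<close>
  have super: "f h + f k \<le> f (h + k)" for h k
  proof -
    have "s \<le> f (h + k) - t" if "s \<in> L h" "t \<in> L k" for s t
      using upper [of "h + k" "s + t"] Madd [of "h - s *\<^sub>R e" "k - t *\<^sub>R e"] that
      by (simp add: L_def algebra_simps)
    then have "f h \<le> f (h + k) - t" if "t \<in> L k" for t
      unfolding f_def [of h] using that Lne by (intro cSup_least) auto
    then have "t \<le> f (h + k) - f h" if "t \<in> L k" for t using that by fastforce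
    then have "f k \<le> f (h + k) - f h"
      unfolding f_def [of k] using Lne by (intro cSup_least) auto
    then show ?thesis by simp
  qed
  have f0: "f 0 = 0" using upper [of 0 0] lower [of 0 0] M0 by simp
  have odd: "f (- h) = - f h" for h
  proof (rule antisym)
    show "f (- h) \<le> - f h" using super [of h "- h"] f0 by simp
    have "- t \<le> f (- h)" if "t > f h" for t
    proof -
      have "h - t *\<^sub>R e \<notin> M" using upper [of h t] that by auto
      then have "- h - (- t) *\<^sub>R e \<in> M" using total by fastforce
      then show ?thesis by (rule upper)
    qed
    then have "- f (- h) \<le> t" if "t > f h" for t using that by fastforce
    then have "- f (- h) \<le> f h" by (rule dense_ge)
    then show "- f h \<le> f (- h)" by simp
  qed
  have fadd: "f (h + k) = f h + f k" for h k
    using super [of h k] super [of "- h" "- k"] odd [of "h + k"] odd by (simp add: algebra_simps)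
  have fscale_pos: "f (r *\<^sub>R h) \<ge> r * f h" if "r > 0" for r h
  proof -
    have "t \<le> f (r *\<^sub>R h) / r" if "t \<in> L h" for t
      using upper [of "r *\<^sub>R h" "r * t"] Mscale [of r "h - t *\<^sub>R e"] that \<open>r > 0\<close>
      by (simp add: L_def algebra_simps field_simps)
    then have "f h \<le> f (r *\<^sub>R h) / r" unfolding f_def [of h] using Lne by (intro cSup_least) auto
    then show ?thesis using \<open>r > 0\<close> by (simp add: field_simps)
  qed
  have fscale_pos': "f (r *\<^sub>R h) = r * f h" if "r > 0" for r h
    using fscale_pos [OF that, of h] fscale_pos [OF that, of "- h"] odd by simp
  have fscale: "f (r *\<^sub>R h) = r * f h" for r h
    using fscale_pos' [of r h] fscale_pos' [of "- r" h] odd [of "r *\<^sub>R h"] f0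
    by (cases r "0::real" rule: linorder_cases) auto
  show thesis
  proof
    show "linear f" using fadd fscale by (intro linearI) auto
    show "f h \<ge> 0" if "h \<in> C" for h using upper [of h 0] that CM by auto
    show "f e = 1" using upper [of e 1] lower [of 1 e] M0 by simp
  qed
qed
section \<open>Scalars, involution and norm\<close>

lemma scaleC_minus_one: "(- 1) *\<^sub>C (x::'a::complex_vector) = - x"
  using scaleR_scaleC [of "-1" x] by simp

lemma scaleC_commute_scaleR: "c *\<^sub>C (r *\<^sub>R x) = r *\<^sub>R (c *\<^sub>C (x::'a::complex_vector))"
  by (simp add: scaleR_scaleC scaleC_scaleC mult.commute)

lemma scaleC_minus_right: "c *\<^sub>C (- x) = - (c *\<^sub>C (x::'a::complex_vector))"
  using scaleC_commute_scaleR [of c "-1" x] by simp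

lemma scaleC_diff_right: "c *\<^sub>C (x - y) = c *\<^sub>C x - c *\<^sub>C (y::'a::complex_vector)"
  using scaleC_add_right [of c x "- y"] by (simp add: scaleC_minus_right)

lemma scaleC_minus_left: "(- c) *\<^sub>C x = - (c *\<^sub>C (x::'a::complex_vector))"
  using scaleC_scaleC [of "-1" c x] by (simp add: scaleC_minus_one)

lemma star_scaleR: "star (r *\<^sub>R x) = r *\<^sub>R star (x::'a::unital_cstar_algebra)"
  by (simp add: scaleR_scaleC star_scaleC)

lemma star_minus: "star (- x) = - star (x::'a::unital_cstar_algebra)"
  using star_scaleR [of "-1" x] by simp

lemma star_diff: "star (x - y) = star x - star (y::'a::unital_cstar_algebra)"
  using star_add [of x "- y"] by (simp add: star_minus)

lemma star_zero: "star (0::'a::unital_cstar_algebra) = 0"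
  using star_diff [of 0 0] by simp

lemma star_one: "star (1::'a::unital_cstar_algebra) = 1"
  by (metis mult_1_right star_mult star_star)

lemma star_power: "star (x ^ n) = star (x::'a::unital_cstar_algebra) ^ n"
  by (induction n) (simp_all add: star_one star_mult power_commutes)

lemmas star_simps = star_star star_add star_diff star_minus star_scaleR star_mult star_zero star_one star_power

lemma norm_le_norm_star: "norm x \<le> norm (star (x::'a::unital_cstar_algebra))"
proof (cases "x = 0")
  case False
  have "norm x * norm x \<le> norm (star x) * norm x"
    using norm_mult_ineq [of "star x" x] norm_star_mult_self [of x] by (simp add: power2_eq_square)
  then show ?thesis using False by simp
qed simp

lemma norm_star: "norm (star x) = norm (x::'a::unital_cstar_algebra)"
  using norm_le_norm_star [of x] norm_le_norm_star [of "star x"] by (simp add: star_star)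

lemma bounded_linear_star: "bounded_linear (star :: 'a::unital_cstar_algebra \<Rightarrow> 'a)"
  by (rule bounded_linear_intro [where K = 1]) (simp_all add: star_simps norm_star)

lemma norm_selfadjoint_square:
  fixes h :: "'a::unital_cstar_algebra"
  assumes "star h = h" shows "norm (h * h) = (norm h)\<^sup>2"
  using norm_star_mult_self [of h] assms by simp

lemma selfadjoint_square_eq_0:
  fixes h :: "'a::unital_cstar_algebra"
  assumes "star h = h" "h * h = 0" shows "h = 0"
  using norm_selfadjoint_square [OF assms(1)] assms(2) by simp

text \<open>
  With \<open>z = s + \<i> r\<close> one has \<open>z\<^sup>* z = s\<^sup>2 + r\<^sup>2\<close>, and \<open>s\<close> is the real part of \<open>z\<close>, whence \<open>\<parallel>s\<parallel> \<le> \<parallel>z\<parallel>\<close>.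
  This replaces functional calculus wherever norms of commuting squares are compared.
\<close>

lemma norm_le_norm_sum_squares:
  fixes s r :: "'a::unital_cstar_algebra"
  assumes s: "star s = s" and r: "star r = r" and comm: "s * r = r * s"
  shows "norm (s * s) \<le> norm (s * s + r * r)"
proof -
  define z where "z = s + \<i> *\<^sub>C r"
  have sz: "star z = s - \<i> *\<^sub>C r"
    by (simp add: z_def star_add star_scaleC s r scaleC_minus_left)
  have "\<i> *\<^sub>C \<i> *\<^sub>C (r * r) = - (r * r)"
    by (simp add: scaleC_scaleC scaleC_minus_one)
  then have "star z * z = s * s + r * r"
    unfolding sz by (simp add: z_def algebra_simps scaleC_mult_left scaleC_mult_right scaleC_diff_right comm)
  then have nz: "(norm z)\<^sup>2 = norm (s * s + r * r)"
    using norm_star_mult_self [of z] by simp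
  have "2 *\<^sub>R s = z + star z" unfolding sz by (simp add: z_def scaleR_2)
  then have "2 * norm s \<le> norm z + norm (star z)"
    using norm_triangle_ineq [of z "star z"] by (metis norm_scaleR abs_numeral)
  then have "norm s \<le> norm z" by (simp add: norm_star)
  then show ?thesis
    by (simp add: norm_selfadjoint_square [OF s] nz [symmetric] power_mono)
qed

section \<open>Square roots by power series\<close>

text \<open>
  The series of \<open>1 - sqrt (1 - k)\<close>. Leaving out the constant term of \<open>sqrt (1 - k)\<close> keeps all
  coefficients nonnegative; the square root itself is \<open>1 - sqrt_series k\<close>.
\<close>

definition sqrt_series :: "'a::unital_cstar_algebra \<Rightarrow> 'a" where
  "sqrt_series k = (\<Sum>n. sqrt_coeff n *\<^sub>R k ^ n)"

context
  fixes k :: "'a::unital_cstar_algebra"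
  assumes k: "norm k \<le> 1"
begin

lemma norm_sqrt_series_term_le: "norm (sqrt_coeff n *\<^sub>R k ^ n) \<le> sqrt_coeff n"
proof -
  have "norm (k ^ n) \<le> 1"
    using norm_power_ineq [of k n] power_le_one [OF norm_ge_zero k, of n] by linarith
  then show ?thesis using mult_left_mono [of "norm (k ^ n)" 1 "sqrt_coeff n"]
    by (simp add: sqrt_coeff_nonneg)
qed

lemma summable_norm_sqrt_series: "summable (\<lambda>n. norm (sqrt_coeff n *\<^sub>R k ^ n))"
  by (rule summable_comparison_test' [OF summable_sqrt_coeff, of 0])
     (use norm_sqrt_series_term_le in simp)

lemma summable_sqrt_series: "summable (\<lambda>n. sqrt_coeff n *\<^sub>R k ^ n)"
  using summable_norm_sqrt_series by (rule summable_norm_cancel)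

lemma norm_sqrt_series_le: "norm (sqrt_series k) \<le> 1"
proof -
  have "norm (sqrt_series k) \<le> (\<Sum>n. norm (sqrt_coeff n *\<^sub>R k ^ n))"
    unfolding sqrt_series_def by (rule summable_norm [OF summable_norm_sqrt_series])
  also have "\<dots> \<le> (\<Sum>n. sqrt_coeff n)"
    by (rule suminf_le [OF norm_sqrt_series_term_le summable_norm_sqrt_series summable_sqrt_coeff])
  also have "\<dots> \<le> 1" by (rule suminf_sqrt_coeff_le)
  finally show ?thesis .
qed

lemma square_one_minus_sqrt_series: "(1 - sqrt_series k) * (1 - sqrt_series k) = 1 - k"
proof -
  let ?a = "\<lambda>n. sqrt_coeff n *\<^sub>R k ^ n"
  have "(\<lambda>n. \<Sum>i\<le>n. ?a i * ?a (n - i)) sums (sqrt_series k * sqrt_series k)"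
    unfolding sqrt_series_def by (intro Cauchy_product_sums summable_norm_sqrt_series)
  moreover have "(\<Sum>i\<le>n. ?a i * ?a (n - i)) = 2 *\<^sub>R ?a n - (if n = 1 then k else 0)" for n
  proof -
    have "(\<Sum>i\<le>n. ?a i * ?a (n - i)) = (\<Sum>i\<le>n. (sqrt_coeff i * sqrt_coeff (n - i)) *\<^sub>R k ^ n)"
      by (intro sum.cong refl) (simp add: power_add [symmetric])
    also have "\<dots> = (2 * sqrt_coeff n - (if n = 1 then 1 else 0)) *\<^sub>R k ^ n"
      by (simp only: scaleR_sum_left [symmetric] sqrt_coeff_convolution)
    finally show ?thesis by (auto simp: algebra_simps)
  qed
  moreover have "(\<lambda>n. 2 *\<^sub>R ?a n - (if n = 1 then k else 0)) sums (2 *\<^sub>R sqrt_series k - k)"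
    unfolding sqrt_series_def
    by (intro sums_diff sums_scaleR_right summable_sums summable_sqrt_series) (rule sums_single)
  ultimately have "sqrt_series k * sqrt_series k = 2 *\<^sub>R sqrt_series k - k"
    using sums_unique2 by simp
  then show ?thesis by (simp add: algebra_simps scaleR_2)
qed

lemma star_sqrt_series:
  assumes "star k = k" shows "star (sqrt_series k) = sqrt_series k"
  unfolding sqrt_series_def bounded_linear.suminf [OF bounded_linear_star summable_sqrt_series]
  by (simp add: star_simps assms)

end

text \<open>
  The case \<open>k = l\<close> says that the root commutes with everything that \<open>k\<close> commutes with; two different
  elements are needed to carry square roots from \<open>z z\<^sup>*\<close> to \<open>z\<^sup>* z\<close>.
\<close>

lemma sqrt_series_intertwines:
  fixes k l z :: "'a::unital_cstar_algebra"
  assumes "norm k \<le> 1" "norm l \<le> 1" and kl: "k * z = z * l"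
  shows "sqrt_series k * z = z * sqrt_series l"
proof -
  have "k ^ n * z = z * l ^ n" for n
    by (induction n) (simp_all add: mult.assoc kl power_commutes, metis kl mult.assoc power_commutes)
  then show ?thesis
    unfolding sqrt_series_def
    by (simp add: suminf_mult [symmetric] suminf_mult2 summable_sqrt_series assms)
qed

section \<open>Positive elements and their square roots\<close>

text \<open>
  For a self-adjoint \<open>h\<close> this says that the spectrum of \<open>h\<close> lies in the half-line \<open>[0, \<infinity>)\<close>, but in terms
  of the norm only. The real \<open>t\<close> is automatically nonnegative.
\<close>

definition is_positive :: "'a::unital_cstar_algebra \<Rightarrow> bool" where
  "is_positive h \<longleftrightarrow> star h = h \<and> (\<exists>t. norm (t *\<^sub>R 1 - h) \<le> t)"

lemma positive_selfadjoint: "is_positive h \<Longrightarrow> star h = h"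
  by (simp add: is_positive_def)

lemma positive_add:
  assumes "is_positive p" "is_positive q" shows "is_positive (p + q)"
proof -
  obtain s t where "norm (s *\<^sub>R 1 - p) \<le> s" "norm (t *\<^sub>R 1 - q) \<le> t"
    using assms by (auto simp: is_positive_def)
  moreover have "(s + t) *\<^sub>R 1 - (p + q) = (s *\<^sub>R 1 - p) + (t *\<^sub>R 1 - q)"
    by (simp add: algebra_simps)
  ultimately have "norm ((s + t) *\<^sub>R 1 - (p + q)) \<le> s + t"
    using norm_triangle_mono by metis
  then show ?thesis using assms by (auto simp: is_positive_def star_simps)
qed

lemma positive_scaleR:
  assumes "is_positive p" "r \<ge> 0" shows "is_positive (r *\<^sub>R p)"
proof -
  obtain t where t: "norm (t *\<^sub>R 1 - p) \<le> t"
    using assms by (auto simp: is_positive_def)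
  have "(r * t) *\<^sub>R 1 - r *\<^sub>R p = r *\<^sub>R (t *\<^sub>R 1 - p)"
    by (simp add: algebra_simps)
  then have "norm ((r * t) *\<^sub>R 1 - r *\<^sub>R p) \<le> r * t"
    using t assms by (simp add: mult_left_mono)
  then show ?thesis using assms by (auto simp: is_positive_def star_simps)
qed

lemma positive_scaleR_one: "t \<ge> 0 \<Longrightarrow> is_positive (t *\<^sub>R 1)"
  by (auto simp: is_positive_def star_simps intro!: exI [of _ t])

text \<open>
  The element \<open>1 - h\<^sup>2\<close> has a self-adjoint square root \<open>s\<close> that commutes with \<open>h\<close>, and \<open>s\<^sup>2\<close> is dominated
  in norm by \<open>s\<^sup>2 + h\<^sup>2 = 1\<close>.
\<close>

lemma norm_one_minus_square_le:
  fixes h :: "'a::unital_cstar_algebra"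
  assumes h: "star h = h" and "norm h \<le> 1"
  shows "norm (1 - h * h) \<le> 1"
proof -
  define s where "s = 1 - sqrt_series (h * h)"
  have n: "norm (h * h) \<le> 1" using assms by (simp add: norm_selfadjoint_square power_le_one)
  have "s * s = 1 - h * h" unfolding s_def by (rule square_one_minus_sqrt_series [OF n])
  moreover have "star s = s" using n h by (simp add: s_def star_simps star_sqrt_series)
  moreover have "s * h = h * s"
    using sqrt_series_intertwines [OF n n, of h] by (simp add: s_def algebra_simps)
  ultimately show ?thesis using norm_le_norm_sum_squares [of s h] h by simp
qed

lemma positive_square:
  fixes h :: "'a::unital_cstar_algebra"
  assumes h: "star h = h" shows "is_positive (h * h)"
proof (cases "h = 0")
  case True then show ?thesis using positive_scaleR_one [of 0] by simp
next
  case False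
  define g where "g = (1 / norm h) *\<^sub>R h"
  have "star g = g" "norm g \<le> 1" using False h by (simp_all add: g_def star_simps)
  then have "is_positive (g * g)"
    using norm_one_minus_square_le [of g] by (auto simp: is_positive_def star_simps intro!: exI [of _ 1])
  moreover have "h * h = (norm h)\<^sup>2 *\<^sub>R (g * g)" using False by (simp add: g_def power2_eq_square)
  ultimately show ?thesis by (simp add: positive_scaleR)
qed

text \<open>
  Write \<open>p = t (1 - k)\<close> with \<open>\<parallel>k\<parallel> \<le> 1\<close>. The root \<open>1 - sqrt_series k\<close> is itself positive because the
  series has norm at most \<open>1\<close>.
\<close>

lemma positive_sqrt:
  fixes p :: "'a::unital_cstar_algebra"
  assumes "is_positive p"
  obtains r where "is_positive r" "r * r = p" "\<And>y. p * y = y * p \<Longrightarrow> r * y = y * r"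
proof -
  obtain t where t: "norm (t *\<^sub>R 1 - p) \<le> t" and p: "star p = p"
    using assms by (auto simp: is_positive_def)
  have "t \<ge> 0" using t norm_ge_zero order_trans by blast
  show thesis
  proof (cases "t = 0")
    case True
    then have "p = 0" using t by simp
    then show thesis using that [of 0] positive_scaleR_one [of 0] by simp
  next
    case False
    with \<open>t \<ge> 0\<close> have "t > 0" by simp
    define k where "k = 1 - (1 / t) *\<^sub>R p"
    have "k = (1 / t) *\<^sub>R (t *\<^sub>R 1 - p)" using \<open>t > 0\<close> by (simp add: k_def algebra_simps)
    then have k: "norm k \<le> 1" using t \<open>t > 0\<close> by simp
    have sk: "star k = k" by (simp add: k_def star_simps p)
    define s where "s = 1 - sqrt_series k"
    have s: "is_positive s"
      using norm_sqrt_series_le [OF k] star_sqrt_series [OF k sk]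
      by (auto simp: is_positive_def s_def star_simps intro!: exI [of _ 1])
    have ss: "s * s = (1 / t) *\<^sub>R p"
      using square_one_minus_sqrt_series [OF k] by (simp add: s_def k_def)
    show thesis
    proof
      show "is_positive (sqrt t *\<^sub>R s)" using s \<open>t > 0\<close> by (simp add: positive_scaleR)
      show "sqrt t *\<^sub>R s * sqrt t *\<^sub>R s = p" using \<open>t > 0\<close> by (simp add: ss)
      fix y assume "p * y = y * p"
      then have "k * y = y * k" by (simp add: k_def algebra_simps)
      then have "sqrt_series k * y = y * sqrt_series k" by (rule sqrt_series_intertwines [OF k k])
      then show "sqrt t *\<^sub>R s * y = y * sqrt t *\<^sub>R s" by (simp add: s_def algebra_simps)
    qed
  qed
qed

lemma norm_le_norm_add_positive:
  fixes p q :: "'a::unital_cstar_algebra"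
  assumes "is_positive p" "is_positive q" "p * q = q * p"
  shows "norm p \<le> norm (p + q)"
proof -
  obtain r where r: "is_positive r" "r * r = p" "\<And>y. p * y = y * p \<Longrightarrow> r * y = y * r"
    using positive_sqrt [OF assms(1)] by blast
  obtain s where s: "is_positive s" "s * s = q" "\<And>y. q * y = y * q \<Longrightarrow> s * y = y * s"
    using positive_sqrt [OF assms(2)] by blast
  have "r * s = s * r" using r(3) s(3) assms(3) by metis
  then show ?thesis
    using norm_le_norm_sum_squares [of r s] r s positive_selfadjoint by metis
qed

lemma positive_and_negative_eq_0:
  fixes p :: "'a::unital_cstar_algebra"
  assumes "is_positive p" "is_positive (- p)" shows "p = 0"
  using norm_le_norm_add_positive [OF assms] by simp

lemma positive_mult_square:
  fixes p d :: "'a::unital_cstar_algebra"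
  assumes "is_positive p" "star d = d" "p * d = d * p"
  shows "is_positive (p * (d * d))"
proof -
  obtain r where r: "is_positive r" "r * r = p" "r * d = d * r"
    using positive_sqrt [OF assms(1)] assms(3) by metis
  have "star (r * d) = r * d" using r assms(2) positive_selfadjoint by (metis star_mult)
  moreover have "(r * d) * (r * d) = p * (d * d)" using r by (metis mult.assoc)
  ultimately show ?thesis using positive_square by metis
qed

lemma selfadjoint_cube_eq_0:
  fixes d :: "'a::unital_cstar_algebra"
  assumes "star d = d" "d * (d * d) = 0" shows "d = 0"
proof -
  have "(d * d) * (d * d) = 0" using assms(2) by (metis mult.assoc mult_zero_left)
  then have "d * d = 0" using assms(1) by (intro selfadjoint_square_eq_0 [of "d * d"]) (simp_all add: star_simps)
  then show ?thesis by (rule selfadjoint_square_eq_0 [OF assms(1)])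
qed

text \<open>
  With \<open>d = p - w\<close> the sum of the positive elements \<open>p d\<^sup>2\<close> and \<open>w d\<^sup>2\<close> is \<open>(p + w) (p - w) d = 0\<close>, so
  both vanish, and so does their difference \<open>d\<^sup>3\<close>.
\<close>

lemma positive_sqrt_unique:
  fixes p w :: "'a::unital_cstar_algebra"
  assumes "is_positive p" "is_positive w" "p * w = w * p" "p * p = w * w"
  shows "p = w"
proof -
  define d where "d = p - w"
  have sd: "star d = d" using assms(1,2) [THEN positive_selfadjoint] by (simp add: d_def star_simps)
  have pd: "p * d = d * p" and wd: "w * d = d * w"
    using assms(3) by (simp_all add: d_def algebra_simps)
  have "(p + w) * d = 0" using assms by (simp add: d_def algebra_simps)
  then have z: "p * (d * d) + w * (d * d) = 0"
    by (simp add: distrib_right [symmetric] mult.assoc [symmetric])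
  have "is_positive (p * (d * d))" "is_positive (w * (d * d))"
    using assms(1,2) sd pd wd by (simp_all add: positive_mult_square)
  moreover have "w * (d * d) = - (p * (d * d))" using z by (simp add: add_eq_0_iff)
  ultimately have "p * (d * d) = 0" "w * (d * d) = 0"
    using positive_and_negative_eq_0 [of "p * (d * d)"] by simp_all
  then have "d * (d * d) = 0" by (simp add: d_def left_diff_distrib)
  then show ?thesis using selfadjoint_cube_eq_0 [OF sd] by (simp add: d_def)
qed

lemma positive_series_sqrt_square:
  fixes p :: "'a::unital_cstar_algebra"
  assumes p: "is_positive p" and "norm p \<le> 1"
  shows "1 - sqrt_series (1 - p * p) = p"
proof -
  have sp: "star p = p" using p by (rule positive_selfadjoint)
  have n: "norm (1 - p * p) \<le> 1" using norm_one_minus_square_le [OF sp] assms by simp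
  define w where "w = 1 - sqrt_series (1 - p * p)"
  have "is_positive w" unfolding is_positive_def
    using norm_sqrt_series_le [OF n] star_sqrt_series [OF n] sp
    by (auto simp: w_def star_simps intro!: exI [of _ 1])
  moreover have "w * w = p * p" using square_one_minus_sqrt_series [OF n] by (simp add: w_def)
  moreover have "(1 - p * p) * p = p * (1 - p * p)" by (simp add: algebra_simps)
  then have "p * w = w * p" using sqrt_series_intertwines [OF n n, of p] by (simp add: w_def algebra_simps)
  ultimately have "p = w" using positive_sqrt_unique [OF p, of w] by simp
  then show ?thesis by (simp add: w_def)
qed

text \<open>
  After scaling into the unit ball, both \<open>p\<close> and \<open>q\<close> are recovered from their squares by the same
  power series, and power series preserve intertwining relations.
\<close>

lemma positive_intertwines_if_squares:
  fixes p q z :: "'a::unital_cstar_algebra"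
  assumes p: "is_positive p" and q: "is_positive q" and pq: "p * p * z = z * (q * q)"
  shows "p * z = z * q"
proof -
  define c where "c = 1 / (norm p + norm q + 1)"
  have c: "c > 0" "norm (c *\<^sub>R p) \<le> 1" "norm (c *\<^sub>R q) \<le> 1"
    unfolding c_def by (simp_all add: add_nonneg_pos divide_simps)
  define P where "P = c *\<^sub>R p" 
  define Q where "Q = c *\<^sub>R q"
  have P: "is_positive P" "norm P \<le> 1" and Q: "is_positive Q" "norm Q \<le> 1"
    using p q c by (simp_all add: P_def Q_def positive_scaleR)
  have "(1 - P * P) * z = z * (1 - Q * Q)"
    using pq by (simp add: P_def Q_def algebra_simps)
  then have "sqrt_series (1 - P * P) * z = z * sqrt_series (1 - Q * Q)"
    using P Q norm_one_minus_square_le positive_selfadjoint by (intro sqrt_series_intertwines) auto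
  then have "(1 - sqrt_series (1 - P * P)) * z = z * (1 - sqrt_series (1 - Q * Q))"
    by (simp add: algebra_simps)
  then have "P * z = z * Q" using P Q by (simp add: positive_series_sqrt_square)
  then show ?thesis using c by (simp add: P_def Q_def)
qed

section \<open>Positivity of star y * y\<close>

text \<open>
  If \<open>z = a + \<i> b\<close> with \<open>a\<close>, \<open>b\<close> self-adjoint, then \<open>z\<^sup>* z + z z\<^sup>* = 2 (a\<^sup>2 + b\<^sup>2)\<close>. So if
  \<open>q = - z\<^sup>* z\<close> is positive, then \<open>p = z z\<^sup>*\<close> is positive too. Usually one now compares the spectra of
  \<open>z\<^sup>* z\<close> and \<open>z z\<^sup>*\<close>. Here the obvious relation \<open>p z = - z q\<close> gives \<open>p\<^sup>2 z = z q\<^sup>2\<close>, hence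
  \<open>p z = z q\<close> by taking positive roots, and the two relations together force \<open>z q = 0\<close>.
\<close>

lemma star_mult_self_negative_imp_0:
  fixes z :: "'a::unital_cstar_algebra"
  assumes "is_positive (- (star z * z))"
  shows "z = 0"
proof -
  define q where "q = - (star z * z)"
  define p where "p = z * star z"
  define a where "a = (1/2) *\<^sub>R (z + star z)"
  define b where "b = (1/2) *\<^sub>R (\<i> *\<^sub>C (star z - z))"
  have sa: "star a = a" by (simp add: a_def star_simps add.commute)
  have sb: "star b = b"
    by (simp add: b_def star_simps star_scaleC scaleC_minus_left flip: scaleC_minus_right)
  have "b * b = - ((1/4) *\<^sub>R ((star z - z) * (star z - z)))"
    by (simp add: b_def scaleC_mult_left scaleC_mult_right scaleC_scaleC scaleC_minus_one scaleC_commute_scaleR)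
  then have "4 *\<^sub>R (b * b) = - ((star z - z) * (star z - z))" by simp
  moreover have "4 *\<^sub>R (a * a) = (z + star z) * (z + star z)" by (simp add: a_def)
  ultimately have "4 *\<^sub>R (a * a + b * b) = (z + star z) * (z + star z) - (star z - z) * (star z - z)"
    by (simp only: scaleR_add_right) simp
  also have "\<dots> = 2 *\<^sub>R (star z * z + z * star z)"
    by (simp add: algebra_simps scaleR_2)
  finally have "2 *\<^sub>R (2 *\<^sub>R (a * a + b * b)) = 2 *\<^sub>R (star z * z + z * star z)" by simp
  then have "2 *\<^sub>R (a * a + b * b) = star z * z + z * star z"
    by (simp only: scaleR_cancel_left) simp
  then have "p = 2 *\<^sub>R (a * a + b * b) + q"
    by (simp add: p_def q_def)
  moreover have "is_positive (2 *\<^sub>R (a * a + b * b) + q)"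
    using assms sa sb unfolding q_def
    by (intro positive_add positive_scaleR positive_square) auto
  ultimately have p: "is_positive p" by simp
  have q: "is_positive q" using assms by (simp add: q_def)
  have pz: "p * z = - (z * q)" by (simp add: p_def q_def mult.assoc)
  then have "p * p * z = z * (q * q)" by (simp add: mult.assoc) (simp add: mult.assoc [symmetric] pz)
  with p q have zq: "p * z = z * q" by (rule positive_intertwines_if_squares)
  have "2 *\<^sub>R (z * q) = z * q + p * z" by (simp only: zq scaleR_2)
  also have "\<dots> = 0" by (simp only: pz right_minus)
  finally have "z * q = 0" by simp
  then have "star z * z * q = 0" by (simp add: mult.assoc)
  then have "q * q = 0" by (simp add: q_def)
  then have "q = 0" using selfadjoint_square_eq_0 q positive_selfadjoint by blast
  then show ?thesis using norm_star_mult_self [of z] by (simp add: q_def)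
qed

text \<open>
  Let \<open>h = y\<^sup>* y\<close> and let \<open>w\<close> be its absolute value, the positive root of \<open>h\<^sup>2\<close>. The difference
  \<open>v = w - h\<close>, twice the negative part of \<open>h\<close>, satisfies \<open>h v = - w v\<close>, so
  \<open>(y v)\<^sup>* (y v) = v h v = - w v\<^sup>2\<close> is negative and \<open>y v\<close> vanishes. It follows that \<open>v = 0\<close>, that
  is, \<open>h = w\<close>.
\<close>

lemma positive_star_mult_self:
  fixes y :: "'a::unital_cstar_algebra"
  shows "is_positive (star y * y)"
proof -
  define h where "h = star y * y"
  have sh: "star h = h" by (simp add: h_def star_simps)
  obtain w where w: "is_positive w" "w * w = h * h" "w * h = h * w"
    using positive_sqrt [OF positive_square [OF sh]] by (metis mult.assoc)
  define v where "v = w - h"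
  have sv: "star v = v" using w sh positive_selfadjoint by (simp add: v_def star_simps)
  have wv: "w * v = v * w" using w by (simp add: v_def algebra_simps)
  have hv: "h * v = - (w * v)" using w by (simp add: v_def algebra_simps)
  have "star (y * v) * (y * v) = v * (h * v)"
    by (simp add: star_simps sv h_def mult.assoc)
  also have "\<dots> = - (w * (v * v))" by (simp add: hv) (metis mult.assoc wv)
  finally have yv: "star (y * v) * (y * v) = - (w * (v * v))" .
  have "is_positive (w * (v * v))" using w sv wv by (intro positive_mult_square)
  then have "y * v = 0" using yv by (intro star_mult_self_negative_imp_0) simp
  then have "h * v = 0" by (simp add: h_def mult.assoc)
  then have "w * v = 0" using hv by simp
  have "v * v = w * v - h * v" by (simp add: v_def left_diff_distrib)
  also have "\<dots> = 0" using \<open>h * v = 0\<close> \<open>w * v = 0\<close> by simp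
  finally have "v = 0" using selfadjoint_square_eq_0 sv by blast
  then show ?thesis using w by (simp add: v_def h_def)
qed

section \<open>Invertibility and the spectrum of self-adjoint elements\<close>

lemma invertible_one_minus:
  fixes k :: "'a::unital_cstar_algebra"
  assumes "norm k < 1" shows "invertible_element (1 - k)"
proof -
  have sm: "summable (\<lambda>n. k ^ n)"
  proof (rule summable_comparison_test')
    show "summable (\<lambda>n. norm k ^ n)" using assms by (intro summable_geometric) simp
    show "norm (k ^ n) \<le> norm k ^ n" for n by (rule norm_power_ineq)
  qed
  have split: "(\<Sum>n. k ^ n) = 1 + (\<Sum>n. k ^ Suc n)"
    using suminf_split_head [OF sm] by simp
  have "k * (\<Sum>n. k ^ n) = (\<Sum>n. k ^ Suc n)" "(\<Sum>n. k ^ n) * k = (\<Sum>n. k ^ Suc n)"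
    using suminf_mult [OF sm, of k] suminf_mult2 [OF sm, of k] by (simp_all add: power_commutes)
  then show ?thesis unfolding invertible_element_def
    using split by (intro exI [of _ "\<Sum>n. k ^ n"]) (simp add: algebra_simps)
qed

lemma invertible_scaleR:
  fixes x :: "'a::unital_cstar_algebra"
  assumes "invertible_element x" "r \<noteq> 0" shows "invertible_element (r *\<^sub>R x)"
proof -
  obtain y where "x * y = 1" "y * x = 1" using assms by (auto simp: invertible_element_def)
  then show ?thesis unfolding invertible_element_def
    using assms by (intro exI [of _ "(1 / r) *\<^sub>R y"]) simp
qed

text \<open>
  Since \<open>\<parallel>t 1 - p\<parallel> \<le> t < t + \<epsilon>\<close>, the element \<open>\<epsilon> 1 + p = (t + \<epsilon>) 1 - (t 1 - p)\<close> is inverted by a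
  Neumann series.
\<close>

lemma invertible_add_positive:
  fixes p :: "'a::unital_cstar_algebra"
  assumes "is_positive p" "\<epsilon> > 0" shows "invertible_element (\<epsilon> *\<^sub>R 1 + p)"
proof -
  obtain t where t: "norm (t *\<^sub>R 1 - p) \<le> t" using assms by (auto simp: is_positive_def)
  then have "t \<ge> 0" using norm_ge_zero order_trans by blast
  define k where "k = (1 / (t + \<epsilon>)) *\<^sub>R (t *\<^sub>R 1 - p)"
  have "norm k = norm (t *\<^sub>R 1 - p) / (t + \<epsilon>)"
    unfolding k_def norm_scaleR using assms \<open>t \<ge> 0\<close> by simp
  also have "\<dots> < 1" using t assms \<open>t \<ge> 0\<close> by simp
  finally have "norm k < 1" .
  then have "invertible_element ((t + \<epsilon>) *\<^sub>R (1 - k))"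
    using assms \<open>t \<ge> 0\<close> by (intro invertible_scaleR invertible_one_minus) auto
  moreover have "(t + \<epsilon>) *\<^sub>R k = t *\<^sub>R 1 - p"
    using assms \<open>t \<ge> 0\<close> by (simp add: k_def)
  then have "(t + \<epsilon>) *\<^sub>R (1 - k) = \<epsilon> *\<^sub>R 1 + p"
    unfolding scaleR_diff_right by (simp add: scaleR_add_left)
  ultimately show ?thesis by simp
qed

lemma invertible_commuting_factor:
  fixes a :: "'a::monoid_mult"
  assumes "invertible_element (a * b)" "a * b = b * a" shows "invertible_element a"
proof -
  obtain y where "a * b * y = 1" "y * (a * b) = 1" using assms by (auto simp: invertible_element_def)
  then have "a * (b * y) = 1" "(y * b) * a = 1" using assms(2) by (metis mult.assoc)+
  then show ?thesis unfolding invertible_element_def by (metis mult.assoc mult_1_left mult_1_right)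
qed

text \<open>
  For \<open>\<mu> = \<alpha> + \<i> \<beta>\<close> and \<open>b = x - \<alpha> 1\<close>, the element \<open>x - \<mu> 1\<close> is the factor \<open>b - \<i> \<beta>\<close> of
  \<open>b\<^sup>2 + \<beta>\<^sup>2\<close>, which is invertible unless \<open>\<beta> = 0\<close>.
\<close>

lemma spectrum_selfadjoint_real:
  fixes x :: "'a::unital_cstar_algebra"
  assumes x: "star x = x" and "\<mu> \<in> spectrum x"
  shows "\<mu> \<in> \<real>"
proof (rule ccontr)
  assume "\<mu> \<notin> \<real>"
  define b where "b = x - Re \<mu> *\<^sub>R 1"
  define i where "i = (\<i> * Im \<mu>) *\<^sub>C (1::'a)"
  have "Im \<mu> \<noteq> 0" using \<open>\<mu> \<notin> \<real>\<close> complex_is_Real_iff by blast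
  have "\<mu> *\<^sub>C (1::'a) = (complex_of_real (Re \<mu>) + \<i> * complex_of_real (Im \<mu>)) *\<^sub>C 1"
    by (simp only: complex_eq [symmetric])
  then have mu: "x - \<mu> *\<^sub>C 1 = b - i"
    by (simp add: b_def i_def scaleR_scaleC scaleC_add_left)
  have comm: "i * b = b * i" by (simp add: i_def scaleC_mult_left scaleC_mult_right)
  have "i * i = - ((Im \<mu>)\<^sup>2 *\<^sub>R 1)"
    by (simp add: i_def scaleC_mult_left scaleC_mult_right scaleC_scaleC scaleR_scaleC
        scaleC_minus_left [symmetric] power2_eq_square algebra_simps)
  then have "(b - i) * (b + i) = (Im \<mu>)\<^sup>2 *\<^sub>R 1 + b * b"
    using comm by (simp add: algebra_simps)
  moreover have "is_positive (b * b)" using x by (intro positive_square) (simp add: b_def star_simps)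
  ultimately have "invertible_element ((b - i) * (b + i))"
    using \<open>Im \<mu> \<noteq> 0\<close> invertible_add_positive [of "b * b" "(Im \<mu>)\<^sup>2"] by simp
  moreover have "(b - i) * (b + i) = (b + i) * (b - i)" using comm by (simp add: algebra_simps)
  ultimately have "invertible_element (b - i)" by (rule invertible_commuting_factor)
  then show False using assms(2) mu by (simp add: spectrum_def)
qed

section \<open>States and eigenvalues\<close>

text \<open>
  The functional \<open>f\<close> is the real part of the state in question. Testing \<open>h + h\<^sup>*\<close> in the definition of
  the cone makes both signs of every anti-self-adjoint element belong to it, so \<open>f\<close> vanishes on
  those; this is the compatibility of \<open>f\<close> with \<open>star\<close>.
\<close>

lemma state_vanishing_on_square:
  fixes a :: "'a::unital_cstar_algebra"
  assumes a: "star a = a" and ninv: "\<not> invertible_element a"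
  obtains f :: "'a \<Rightarrow> real"
  where "linear f" "\<And>y. f (star y * y) \<ge> 0" "\<And>y. f (star y) = f y" "f 1 = 1" "f (a * a) = 0"
proof -
  define C where "C = {h. \<exists>s\<ge>0. is_positive (h + star h + s *\<^sub>R (a * a))}"
  have zero: "is_positive (0::'a)" using positive_scaleR_one [of 0] by simp
  have saa: "is_positive (a * a)" using a by (rule positive_square)
  have cone: "convex_cone C"
    unfolding convex_cone_iff
  proof (intro conjI ballI allI impI)
    show "0 \<in> C" using zero by (auto simp: C_def star_simps intro!: exI [of _ 0])
  next
    fix h k assume "h \<in> C" "k \<in> C"
    then obtain s t where st: "s \<ge> 0" "t \<ge> 0" "is_positive (h + star h + s *\<^sub>R (a * a))"
        "is_positive (k + star k + t *\<^sub>R (a * a))" by (auto simp: C_def)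
    then have "is_positive ((h + k) + star (h + k) + (s + t) *\<^sub>R (a * a))"
      using positive_add [OF st(3,4)] by (simp add: star_simps algebra_simps)
    then show "h + k \<in> C" using st by (auto simp: C_def intro!: exI [of _ "s + t"])
  next
    fix h and r :: real assume "h \<in> C" "r \<ge> 0"
    then obtain s where s: "s \<ge> 0" "is_positive (h + star h + s *\<^sub>R (a * a))" by (auto simp: C_def)
    then have "is_positive (r *\<^sub>R h + star (r *\<^sub>R h) + (r * s) *\<^sub>R (a * a))"
      using positive_scaleR [OF s(2) \<open>r \<ge> 0\<close>] by (simp add: star_simps algebra_simps)
    then show "r *\<^sub>R h \<in> C" using s \<open>r \<ge> 0\<close> by (auto simp: C_def intro!: exI [of _ "r * s"])
  qed
  have unit: "\<exists>t. t *\<^sub>R 1 - h \<in> C" for h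
  proof -
    define g where "g = h + star h"
    have "is_positive ((norm g) *\<^sub>R 1 - g)"
      by (auto simp: is_positive_def g_def star_simps add.commute intro!: exI [of _ "norm g"])
    moreover have "(norm g / 2) *\<^sub>R 1 - h + star ((norm g / 2) *\<^sub>R 1 - h) = norm g *\<^sub>R 1 - g"
      by (simp add: g_def star_simps algebra_simps flip: scaleR_add_left)
    ultimately have "(norm g / 2) *\<^sub>R 1 - h \<in> C" by (auto simp: C_def intro!: exI [of _ 0])
    then show ?thesis by blast
  qed
  have proper: "- 1 \<notin> C"
  proof
    assume "- 1 \<in> C"
    then obtain s where s: "s \<ge> 0" "is_positive (- 2 + s *\<^sub>R (a * a))"
      by (auto simp: C_def star_simps)
    have two: "(2::real) *\<^sub>R 1 = (2::'a)" by (simp add: scaleR_2)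
    have "invertible_element (2 *\<^sub>R 1 + (- 2 + s *\<^sub>R (a * a)))"
      using s(2) by (rule invertible_add_positive) simp
    then have "invertible_element (a * (s *\<^sub>R a))" by (simp add: two)
    then show False using ninv invertible_commuting_factor [of a "s *\<^sub>R a"] by simp
  qed
  obtain f :: "'a \<Rightarrow> real" where f: "linear f" and fC: "\<And>h. h \<in> C \<Longrightarrow> f h \<ge> 0" and f1: "f 1 = 1"
    using separating_functional [OF cone unit proper] by blast
  interpret f: linear f by (rule f)
  have fpos: "f h \<ge> 0" if "is_positive h" for h
    using that positive_add [OF that that] positive_selfadjoint [OF that]
    by (intro fC) (auto simp: C_def intro!: exI [of _ 0])
  show thesis
  proof
    show "linear f" "f 1 = 1" by fact+
    show "f (star y * y) \<ge> 0" for y by (rule fpos [OF positive_star_mult_self])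
    have le: "f y \<le> f (star y)" for y
    proof -
      have "star y - y \<in> C" using zero by (auto simp: C_def star_simps intro!: exI [of _ 0])
      then show ?thesis using fC [of "star y - y"] by (simp add: f.diff)
    qed
    show "f (star y) = f y" for y using le [of y] le [of "star y"] by (simp add: star_star)
    have "- (a * a) + star (- (a * a)) + 2 *\<^sub>R (a * a) = 0" using a by (simp add: star_simps scaleR_2)
    then have "- (a * a) \<in> C" using zero unfolding C_def
      by (intro CollectI exI [of _ 2]) simp
    then show "f (a * a) = 0" using fC [of "- (a * a)"] fpos [OF saa] by (simp add: f.neg)
  qed
qed

lemma linear_coeff_eq_0_if_nonneg:
  fixes b c :: real
  assumes "\<And>s. 0 \<le> b + s * c" shows "c = 0"
proof (rule ccontr)
  assume "c \<noteq> 0"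
  then show False using assms [of "- (b + 1) / c"] by simp
qed

theorem theorem5:
  fixes x :: "'a::unital_cstar_algebra" and \<mu> :: complex
  assumes "x = star x"
    and "\<mu> \<in> spectrum x"
  shows "is_eigenvalue \<mu> x"
proof -
  obtain r where r: "\<mu> = complex_of_real r"
    using spectrum_selfadjoint_real [of x \<mu>] assms by (metis Reals_cases)
  define a where "a = x - \<mu> *\<^sub>C 1"
  have sa: "star a = a" using assms(1) by (simp add: a_def star_simps star_scaleC r)
  have "\<not> invertible_element a" using assms(2) by (simp add: spectrum_def a_def)
  then obtain f :: "'a \<Rightarrow> real" where f: "linear f" and fpos: "\<And>y. f (star y * y) \<ge> 0"
    and fstar: "\<And>y. f (star y) = f y" and f1: "f 1 = 1" and faa: "f (a * a) = 0"
    using state_vanishing_on_square [OF sa] by blast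
  interpret f: linear f by (rule f)
  \<comment> \<open>The Cauchy-Schwarz argument: the values of \<open>f\<close> on \<open>(y\<^sup>* + s a)\<^sup>* (y\<^sup>* + s a)\<close> are
    nonnegative, and affine in \<open>s\<close> because \<open>f (a\<^sup>2) = 0\<close>.\<close>
  have fa: "f (y * a) = 0" for y
  proof -
    have "0 \<le> f (y * star y) + s * (2 * f (y * a))" for s
    proof -
      have "star (star y + s *\<^sub>R a) * (star y + s *\<^sub>R a)
          = y * star y + s *\<^sub>R (y * a) + s *\<^sub>R star (y * a) + (s * s) *\<^sub>R (a * a)"
        by (simp add: star_simps sa algebra_simps)
      then show ?thesis
        using fpos [of "star y + s *\<^sub>R a"] by (simp add: f.add f.scale fstar faa)
    qed
    then show ?thesis using linear_coeff_eq_0_if_nonneg by fastforce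
  qed
  \<comment> \<open>The complex linear functional with real part \<open>f\<close>.\<close>
  define E where "E y = Complex (f y) (- f (\<i> *\<^sub>C y))" for y
  have Eadd: "E (y + z) = E y + E z" for y z
    by (simp add: E_def scaleC_add_right f.add complex_eq_iff)
  have Escale: "E (c *\<^sub>C y) = c * E y" for c y
  proof -
    have "c *\<^sub>C y = (complex_of_real (Re c) + complex_of_real (Im c) * \<i>) *\<^sub>C y"
      by (simp add: mult.commute flip: complex_eq)
    also have "\<dots> = Re c *\<^sub>R y + Im c *\<^sub>R (\<i> *\<^sub>C y)"
      by (simp add: scaleC_add_left scaleR_scaleC scaleC_scaleC)
    finally have cy: "c *\<^sub>C y = Re c *\<^sub>R y + Im c *\<^sub>R (\<i> *\<^sub>C y)" .
    have "\<i> *\<^sub>C c *\<^sub>C y = Re c *\<^sub>R (\<i> *\<^sub>C y) - Im c *\<^sub>R y"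
      unfolding cy by (simp add: scaleC_add_right scaleC_commute_scaleR scaleC_scaleC scaleC_minus_one)
    with cy show ?thesis
      by (simp add: E_def f.add f.diff f.scale complex_eq_iff)
  qed
  have "Vector_Spaces.linear scaleC (*) E"
    unfolding Vector_Spaces.linear_iff using Eadd Escale vector_space_scaleC
    by (auto simp: vector_space_def algebra_simps)
  moreover have "E (star y * y) \<in> \<real>\<^sub>\<ge>\<^sub>0" for y
  proof -
    have "f (\<i> *\<^sub>C (star y * y)) = - f (\<i> *\<^sub>C (star y * y))"
      using fstar [of "\<i> *\<^sub>C (star y * y)"]
      by (simp add: star_scaleC star_mult star_star scaleC_minus_left f.neg)
    then show ?thesis using fpos [of y] by (simp add: E_def complex_nonneg_Reals_iff)
  qed
  moreover have "E 1 = 1"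
  proof -
    have "f (\<i> *\<^sub>C 1) = - f (\<i> *\<^sub>C 1)"
      using fstar [of "\<i> *\<^sub>C 1"] by (simp add: star_scaleC star_one scaleC_minus_left f.neg)
    then show ?thesis by (simp add: E_def f1 complex_eq_iff)
  qed
  moreover have "E (y * x) = \<mu> * E y" for y
  proof -
    have "y * x = y * a + \<mu> *\<^sub>C y" by (simp add: a_def algebra_simps scaleC_mult_right)
    moreover have "E (y * a) = 0"
      using fa [of y] fa [of "\<i> *\<^sub>C y"] by (simp add: E_def scaleC_mult_left complex_eq_iff)
    ultimately show ?thesis by (simp add: Eadd Escale)
  qed
  ultimately show ?thesis
    unfolding is_eigenvalue_def is_eigenstate_def state_space_def by blast
qed
end
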